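(* Let $n\ge 1$ and let $v$ be a non-zero element of $\mathbb{C}^n$. Then the complex $n$-dimensional vector space $$\mathcal{E}_v=\{\phi_a:\mathrm{GL}_n(\mathbb{R})\to\mathbb{C}\mid \phi_a(x)=\operatorname{trace}(v^t a x^t),\ a\in\mathbb{C}^n\}$$ is an eigenfamily on the semi-Riemannian Lie group $\mathrm{GL}_n(\mathbb{R})$ such that for all $\phi,\psi\in\mathcal{E}_v$ we have $$\tau(\phi)=-n\cdot\phi\quad\text{and}\quad\kappa(\phi,\psi)=-\phi\cdot\psi.$$
   Context: Elements of $\mathbb{C}^n$ are row vectors, so $v^ta$ is the $n\times n$ matrix $(v_ja_\alpha)_{j\alpha}$. The Lie group $\mathrm{GL}_n(\mathbb{R})$ carries the left-invariant semi-Riemannian metric $g$ determined by $g(Z,W)=-\operatorname{Re}\operatorname{trace}(ZW)=-\operatorname{trace}(ZW)$ on its Lie algebra $\mathfrak{gl}_n(\mathbb{R})=\mathbb{R}^{n\times n}$ (the metric inherited from $\mathrm{GL}_n(\mathbb{C})$). For smooth complex-valued functions $\phi,\psi$, $\tau(\phi)=\operatorname{div}(\nabla\phi)$ is the Laplace-Beltrami operator (tension field) and $\kappa(\phi,\psi)=g(\nabla\phi,\nabla\psi)$ is the conformality operator, where $g$ is extended complex-bilinearly to the complexified tangent bundle. A set $\mathcal{E}$ of complex-valued functions is an eigenfamily if there exist $\lambda,\mu\in\mathbb{C}$ with $\tau(\phi)=\lambda\phi$ and $\kappa(\phi,\psi)=\mu\phi\psi$ for all $\phi,\psi\in\mathcal{E}$.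 *)

theory Defs
  imports "HOL-Analysis.Analysis" "HOL-Library.Function_Algebras"
begin

subsection \<open>Smooth functions\<close>

text \<open>
  All manifolds here are open subsets \<open>U\<close> of a Euclidean space \<open>'a\<close>, with every tangent space
  identified with \<open>'a\<close>.
\<close>

primrec Ck_on :: "nat \<Rightarrow> 'a set \<Rightarrow> ('a::real_normed_vector \<Rightarrow> 'b::real_normed_vector) \<Rightarrow> bool" where
  "Ck_on 0 U f \<longleftrightarrow> continuous_on U f"
| "Ck_on (Suc k) U f \<longleftrightarrow>
     (\<forall>x\<in>U. f differentiable (at x)) \<and> (\<forall>X. Ck_on k U (\<lambda>x. frechet_derivative f (at x) X))"

definition smooth_on :: "'a set \<Rightarrow> ('a::real_normed_vector \<Rightarrow> 'b::real_normed_vector) \<Rightarrow> bool" where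
  "smooth_on U f \<longleftrightarrow> (\<forall>k. Ck_on k U f)"


subsection \<open>Gradient, divergence, Laplace-Beltrami operator\<close>

text \<open>\<open>g x X Y\<close> is the value at the point \<open>x\<close> of the metric on the tangent vectors \<open>X\<close>, \<open>Y\<close>.\<close>

type_synonym 'a metric = "'a \<Rightarrow> 'a \<Rightarrow> 'a \<Rightarrow> real"

definition grad :: "'a::euclidean_space metric \<Rightarrow> ('a \<Rightarrow> real) \<Rightarrow> 'a \<Rightarrow> 'a" where
  "grad g u x = (THE W. \<forall>Y. g x W Y = frechet_derivative u (at x) Y)"

text \<open>
  The Christoffel symbols of the Levi-Civita connection as a bilinear map: the Koszul formula for
  the constant (hence pairwise commuting) vector fields \<open>X\<close>, \<open>Y\<close>, \<open>Z\<close>.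
\<close>

definition christoffel :: "'a::euclidean_space metric \<Rightarrow> 'a \<Rightarrow> 'a \<Rightarrow> 'a \<Rightarrow> 'a" where
  "christoffel g x X Y = (THE W. \<forall>Z. 2 * g x W Z =
       frechet_derivative (\<lambda>y. g y Y Z) (at x) X
     + frechet_derivative (\<lambda>y. g y X Z) (at x) Y
     - frechet_derivative (\<lambda>y. g y X Y) (at x) Z)"

text \<open>The covariant derivative, at the point \<open>x\<close>, of the vector field \<open>V\<close> along the vector \<open>X\<close>.\<close>

definition levi_civita :: "'a::euclidean_space metric \<Rightarrow> 'a \<Rightarrow> ('a \<Rightarrow> 'a) \<Rightarrow> 'a \<Rightarrow> 'a" where
  "levi_civita g X V x = frechet_derivative V (at x) X + christoffel g x X (V x)"

text \<open>
  The divergence is the trace of the endomorphism \<open>X \<mapsto> levi_civita g X V x\<close>.  A trace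
  does not depend on a metric; the Euclidean inner product only extracts matrix entries with
  respect to the basis \<open>Basis\<close>.
\<close>

definition divergence :: "'a::euclidean_space metric \<Rightarrow> ('a \<Rightarrow> 'a) \<Rightarrow> 'a \<Rightarrow> real" where
  "divergence g V x = (\<Sum>b\<in>Basis. levi_civita g b V x \<bullet> b)"

text \<open>
  A pair \<open>(X, Y)\<close> stands for the complexified tangent vector \<open>X + \<i> Y\<close>.  Gradient and divergence
  are extended complex-linearly, the metric complex-bilinearly.
\<close>

definition cgrad :: "'a::euclidean_space metric \<Rightarrow> ('a \<Rightarrow> complex) \<Rightarrow> 'a \<Rightarrow> 'a \<times> 'a" where
  "cgrad g \<phi> x = (grad g (\<lambda>y. Re (\<phi> y)) x, grad g (\<lambda>y. Im (\<phi> y)) x)"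

definition cdivergence :: "'a::euclidean_space metric \<Rightarrow> ('a \<Rightarrow> 'a \<times> 'a) \<Rightarrow> 'a \<Rightarrow> complex" where
  "cdivergence g V x = Complex (divergence g (\<lambda>y. fst (V y)) x) (divergence g (\<lambda>y. snd (V y)) x)"

definition cmetric :: "'a metric \<Rightarrow> 'a \<Rightarrow> 'a \<times> 'a \<Rightarrow> 'a \<times> 'a \<Rightarrow> complex" where
  "cmetric g x V W =
     Complex (g x (fst V) (fst W) - g x (snd V) (snd W))
             (g x (fst V) (snd W) + g x (snd V) (fst W))"

definition tension :: "'a::euclidean_space metric \<Rightarrow> ('a \<Rightarrow> complex) \<Rightarrow> 'a \<Rightarrow> complex" where
  "tension g \<phi> = cdivergence g (cgrad g \<phi>)"

definition conformality ::
    "'a::euclidean_space metric \<Rightarrow> ('a \<Rightarrow> complex) \<Rightarrow> ('a \<Rightarrow> complex) \<Rightarrow> 'a \<Rightarrow> complex" where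
  "conformality g \<phi> \<psi> x = cmetric g x (cgrad g \<phi> x) (cgrad g \<psi> x)"

definition eigenfamily ::
    "'a::euclidean_space set \<Rightarrow> 'a metric \<Rightarrow> ('a \<Rightarrow> complex) set \<Rightarrow> bool" where
  "eigenfamily U g \<E> \<longleftrightarrow>
     (\<forall>\<phi>\<in>\<E>. smooth_on U \<phi>) \<and>
     (\<exists>l m. \<forall>\<phi>\<in>\<E>. \<forall>\<psi>\<in>\<E>. \<forall>x\<in>U.
        tension g \<phi> x = l * \<phi> x \<and> conformality g \<phi> \<psi> x = m * \<phi> x * \<psi> x)"

text \<open>
  At a point where the metric is nondegenerate, the definite descriptions in \<^const>\<open>grad\<close> and
  \<^const>\<open>christoffel\<close> are meaningful.
\<close>

lemma nondegenerate_represents: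
  fixes B :: "'a::euclidean_space \<Rightarrow> 'a \<Rightarrow> real"
  assumes "bilinear B" and nondeg: "\<And>W. (\<And>Y. B W Y = 0) \<Longrightarrow> W = 0" and "linear l"
  shows "\<exists>!W. \<forall>Y. B W Y = l Y"
proof -
  have lin1: "linear (\<lambda>W. B W Y)" and lin2: "linear (B W)" for W Y
    using assms(1) by (auto simp: bilinear_def)
  have rep: "f Y = (\<Sum>b\<in>Basis. f b *\<^sub>R b) \<bullet> Y" if "linear f" for f :: "'a \<Rightarrow> real" and Y
  proof -
    have "f Y = f (\<Sum>b\<in>Basis. (Y \<bullet> b) *\<^sub>R b)"
      by (simp add: euclidean_representation)
    also have "\<dots> = (\<Sum>b\<in>Basis. (Y \<bullet> b) * f b)"
      using that by (simp add: linear_sum linear_scale)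
    finally show ?thesis
      by (simp add: inner_sum_left inner_commute[of Y] mult.commute)
  qed
  define T where "T W = (\<Sum>b\<in>Basis. B W b *\<^sub>R b)" for W
  have BT: "B W Y = T W \<bullet> Y" for W Y
    unfolding T_def by (rule rep[OF lin2])
  have "linear T"
    unfolding T_def
    by (rule linearI)
       (simp_all add: linear_add[OF lin1] linear_scale[OF lin1] scaleR_add_left sum.distrib
         scaleR_sum_right)
  have "inj T"
    using nondeg by (subst linear_injective_0[OF \<open>linear T\<close>]) (auto simp: BT)
  hence "surj T"
    using \<open>linear T\<close> by (rule linear_inj_imp_surj[rotated])
  then obtain W where W: "T W = (\<Sum>b\<in>Basis. l b *\<^sub>R b)"
    unfolding surj_def by metis
  show ?thesis
  proof (rule ex1I[of _ W])
    show "\<forall>Y. B W Y = l Y"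
      unfolding BT W by (intro allI) (rule rep[OF \<open>linear l\<close>, symmetric])
  next
    fix W' assume "\<forall>Y. B W' Y = l Y"
    hence "T W' \<bullet> Y = T W \<bullet> Y" for Y
      unfolding W rep[OF \<open>linear l\<close>, of Y, symmetric] BT[symmetric] by blast
    hence "T W' = T W"
      using vector_eq_rdot by blast
    thus "W' = W" using \<open>inj T\<close> by (simp add: inj_eq)
  qed
qed


subsection \<open>The semi-Riemannian Lie group \<open>GL\<^sub>n(\<real>)\<close>\<close>

definition GL :: "(real^'n^'n) set" where
  "GL = {x. invertible x}"

definition gl_form :: "real^'n^'n \<Rightarrow> real^'n^'n \<Rightarrow> real" where
  "gl_form Z W = - trace (Z ** W)"

text \<open>
  The left-invariant metric extending \<^const>\<open>gl_form\<close>: a tangent vector \<open>X\<close> at \<open>x\<close> is the left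
  translate by \<open>x\<close> of \<open>matrix_inv x ** X\<close>.
\<close>

definition gl_metric :: "(real^'n^'n) metric" where
  "gl_metric x X Y = gl_form (matrix_inv x ** X) (matrix_inv x ** Y)"

lemma open_GL: "open (GL :: (real^'n^'n) set)"
proof -
  have "GL = (\<lambda>x :: real^'n^'n. det x) -` (- {0})"
    by (auto simp: GL_def invertible_det_nz)
  moreover have "continuous_on UNIV (\<lambda>x :: real^'n^'n. det x)"
    unfolding det_def by (intro continuous_intros)
  ultimately show ?thesis
    using open_vimage[of "- {0}" "\<lambda>x :: real^'n^'n. det x"] by (simp add: open_Compl)
qed

lemma matrix_inv_inverse:
  fixes x :: "real^'n^'n"
  assumes "x \<in> GL"
  shows "matrix_inv x ** x = mat 1" "x ** matrix_inv x = mat 1"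
proof -
  have "\<exists>y. x ** y = mat 1 \<and> y ** x = mat 1"
    using assms by (simp add: GL_def invertible_def)
  hence "x ** matrix_inv x = mat 1 \<and> matrix_inv x ** x = mat 1"
    unfolding matrix_inv_def by (rule someI_ex)
  thus "matrix_inv x ** x = mat 1" "x ** matrix_inv x = mat 1" by simp_all
qed

lemma gl_metric_at_one: "gl_metric (mat 1 :: real^'n^'n) = gl_form"
proof -
  have "(mat 1 :: real^'n^'n) \<in> GL"
    by (auto simp: GL_def invertible_def)
  hence "matrix_inv (mat 1 :: real^'n^'n) = mat 1"
    using matrix_inv_inverse(1) by fastforce
  thus ?thesis by (intro ext) (simp add: gl_metric_def)
qed

lemma gl_metric_left_invariant:
  fixes p x :: "real^'n^'n"
  assumes "p \<in> GL" "x \<in> GL"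
  shows "gl_metric (p ** x) (p ** X) (p ** Y) = gl_metric x X Y"
proof -
  have px: "p ** x \<in> GL"
    using assms by (simp add: GL_def invertible_mult)
  have "matrix_inv (p ** x) ** (p ** Z) = matrix_inv x ** Z" for Z :: "real^'n^'n"
  proof -
    have "p ** Z = (p ** x) ** (matrix_inv x ** Z)"
    proof -
      have "(p ** x) ** (matrix_inv x ** Z) = p ** ((x ** matrix_inv x) ** Z)"
        by (simp only: matrix_mul_assoc)
      thus ?thesis by (simp add: matrix_inv_inverse[OF assms(2)])
    qed
    thus ?thesis
      by (simp only: matrix_mul_assoc[of _ "p ** x"] matrix_inv_inverse(1)[OF px] matrix_mul_lid)
  qed
  thus ?thesis by (simp add: gl_metric_def)
qed

lemma gl_metric_symmetric: "gl_metric x X Y = gl_metric x Y X"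
  unfolding gl_metric_def gl_form_def by (subst trace_mul_sym) (rule refl)

lemma gl_metric_bilinear: "bilinear (gl_metric (x :: real^'n^'n))"
proof -
  have tr: "trace (c *\<^sub>R A) = c * trace A" for A :: "real^'n^'n" and c
    by (simp add: trace_def sum_distrib_left)
  have "linear (gl_metric x X)" for X
  proof (rule linearI)
    fix Y Z :: "real^'n^'n" and c :: real
    show "gl_metric x X (Y + Z) = gl_metric x X Y + gl_metric x X Z"
      by (simp add: gl_metric_def gl_form_def matrix_add_ldistrib trace_add)
    have "matrix_inv x ** (c *\<^sub>R Y) = c *\<^sub>R (matrix_inv x ** Y)"
      by (simp only: matrix_scalar_ac scalar_matrix_assoc)
    moreover have "W ** (c *\<^sub>R V) = c *\<^sub>R (W ** V)" for W V :: "real^'n^'n"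
      by (simp only: matrix_scalar_ac scalar_matrix_assoc)
    ultimately show "gl_metric x X (c *\<^sub>R Y) = c *\<^sub>R gl_metric x X Y"
      by (simp add: gl_metric_def gl_form_def tr)
  qed
  moreover have "(\<lambda>X. gl_metric x X Y) = gl_metric x Y" for Y
    by (intro ext) (rule gl_metric_symmetric)
  ultimately show ?thesis
    by (simp add: bilinear_def)
qed

lemma gl_metric_nondegenerate:
  fixes x :: "real^'n^'n"
  assumes "x \<in> GL" and zero: "\<And>Y. gl_metric x W Y = 0"
  shows "W = 0"
proof -
  define A where "A = matrix_inv x ** W"
  have "matrix_inv x ** (x ** transpose A) = transpose A"
    by (simp add: matrix_mul_assoc matrix_inv_inverse[OF assms(1)])
  hence "trace (A ** transpose A) = 0"
    using zero[of "x ** transpose A"] by (simp add: gl_metric_def gl_form_def A_def)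
  hence "(\<Sum>i\<in>UNIV. \<Sum>j\<in>UNIV. (A $ i $ j)\<^sup>2) = 0"
    by (simp add: trace_def matrix_matrix_mult_def transpose_def power2_eq_square)
  hence "A = 0"
    by (simp add: sum_nonneg_eq_0_iff sum_nonneg vec_eq_iff)
  moreover have "W = x ** A"
    by (simp add: A_def matrix_mul_assoc matrix_inv_inverse[OF assms(1)])
  ultimately show ?thesis
    by (simp add: matrix_matrix_mult_def vec_eq_iff)
qed


subsection \<open>The functions \<open>\<phi>\<^sub>a\<close>\<close>

definition outer :: "complex^'n \<Rightarrow> complex^'n \<Rightarrow> complex^'n^'n" where
  "outer v a = (\<chi> j \<alpha>. v $ j * a $ \<alpha>)"

text \<open>
  A function on \<open>GL\<^sub>n(\<real>)\<close> is encoded as a function on all matrices that vanishes off \<^const>\<open>GL\<close>.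
  The pointwise vector space structure is thereby that of the functions on \<open>GL\<^sub>n(\<real>)\<close>, and since
  \<^const>\<open>GL\<close> is open, derivatives at its points do not see the extension.
\<close>

definition phi :: "complex^'n \<Rightarrow> complex^'n \<Rightarrow> real^'n^'n \<Rightarrow> complex" where
  "phi v a x = (if x \<in> GL
     then trace (outer v a ** transpose (map_matrix complex_of_real x)) else 0)"

definition E_fam :: "complex^'n \<Rightarrow> (real^'n^'n \<Rightarrow> complex) set" where
  "E_fam v = {phi v a | a. a \<in> UNIV}"

definition cscale :: "complex \<Rightarrow> ('a \<Rightarrow> complex) \<Rightarrow> 'a \<Rightarrow> complex" where
  "cscale c f = (\<lambda>x. c * f x)"

global_interpretation cfun: vector_space cscale
  by unfold_locales (simp_all add: cscale_def fun_eq_iff distrib_left distrib_right mult.assoc)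

end

theory Submission
  imports Defs
begin

text \<open>
  On \<open>GL\<close> the real and imaginary parts of \<open>\<phi>\<^sub>a\<close> have the form \<open>u(x) = trace(P x)\<close>, with \<open>P\<close> the
  real or imaginary part of \<open>a\<^sup>t v\<close>.  The gradient of such a function is \<open>-x P x\<close>.  By the formula for
  the derivative of the inverse, the Christoffel symbol is \<open>-(X x\<^sup>-\<^sup>1 Y + Y x\<^sup>-\<^sup>1 X) / 2\<close>, so the
  covariant derivative of the gradient is \<open>X \<mapsto> -(X P x + x P X) / 2\<close>, whose trace is \<open>-n u(x)\<close>.
  For \<open>P = a\<^sup>t v\<close> and \<open>Q = b\<^sup>t v\<close>, the metric on the gradients is
  \<open>-trace(P x Q x) = -(v x a\<^sup>t)(v x b\<^sup>t)\<close>.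
\<close>

subsection \<open>Linear functions are smooth\<close>

text \<open>On an open set, derivatives depend only on the values there; this serves
  \<open>phi\<close>, which has a linear formula only on \<open>GL\<close>. The induction varies
  both functions, since its hypothesis is applied to their directional derivatives.\<close>

lemma Ck_on_cong:
  assumes "open U" and "\<And>x. x \<in> U \<Longrightarrow> f x = h x" and "Ck_on k U h"
  shows "Ck_on k U f"
  using assms(2,3)
proof (induction k arbitrary: f h)
  case 0
  then show ?case
    by (simp cong: continuous_on_cong)
next
  case (Suc k)
  have D: "(f has_derivative frechet_derivative h (at x)) (at x)" if "x \<in> U" for x
    using Suc.prems that assms(1)
    by (intro has_derivative_transform_within_open[of h _ x UNIV U f])
       (auto simp: frechet_derivative_works)
  hence eq: "frechet_derivative f (at x) = frechet_derivative h (at x)" if "x \<in> U" for x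
    using frechet_derivative_at[symmetric] that by blast
  have "Ck_on k U (\<lambda>x. frechet_derivative f (at x) X)" for X
    by (rule Suc.IH[of _ "\<lambda>x. frechet_derivative h (at x) X"])
       (use Suc.prems(2) in \<open>simp_all add: eq\<close>)
  moreover have "f differentiable (at x)" if "x \<in> U" for x
    using D[OF that] by (rule differentiableI)
  ultimately show ?case
    by simp
qed

lemma Ck_on_const: "Ck_on k U (\<lambda>x. c)"
  by (induction k arbitrary: c) auto

lemma smooth_on_bounded_linear:
  assumes "bounded_linear f"
  shows "smooth_on U f"
proof -
  have D: "(f has_derivative f) (at x)" for x
    using assms by (rule bounded_linear_imp_has_derivative)
  hence "frechet_derivative f (at x) = f" for x
    by (metis frechet_derivative_at)
  \<comment> \<open>\<open>frechet_derivative f (at x) X\<close> is \<open>f X\<close>, constant in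
    \<open>x\<close>, so a case split on \<open>k\<close> suffices.\<close>
  hence "Ck_on k U f" for k
    using D by (cases k)
      (auto simp: Ck_on_const differentiable_def intro: linear_continuous_on assms)
  thus ?thesis
    by (simp add: smooth_on_def)
qed

subsection \<open>Matrix calculus\<close>

lemma bounded_bilinear_matrix_mul:
  "bounded_bilinear ((**) :: real^'n^'m \<Rightarrow> real^'p^'n \<Rightarrow> real^'p^'m)"
proof -
  have "bilinear ((**) :: real^'n^'m \<Rightarrow> real^'p^'n \<Rightarrow> real^'p^'m)"
    unfolding bilinear_def
    by (auto intro!: linearI simp: matrix_matrix_mult_def vec_eq_iff algebra_simps sum.distrib
        sum_distrib_left)
  thus ?thesis
    by (simp add: bilinear_conv_bounded_bilinear)
qed

lemmas has_derivative_matrix_mul [derivative_intros] =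
  bounded_bilinear.FDERIV[OF bounded_bilinear_matrix_mul]

lemmas matrix_mul_minus_left = bounded_bilinear.minus_left[OF bounded_bilinear_matrix_mul]
lemmas matrix_mul_minus_right = bounded_bilinear.minus_right[OF bounded_bilinear_matrix_mul]
lemmas matrix_mul_scaleR_left = bounded_bilinear.scaleR_left[OF bounded_bilinear_matrix_mul]
lemmas matrix_mul_scaleR_right = bounded_bilinear.scaleR_right[OF bounded_bilinear_matrix_mul]
lemmas matrix_mul_diff_left = bounded_bilinear.diff_left[OF bounded_bilinear_matrix_mul]
lemmas matrix_mul_add_left = bounded_bilinear.add_left[OF bounded_bilinear_matrix_mul]

lemma trace_scaleR: "trace (c *\<^sub>R (A :: real^'n^'n)) = c * trace A"
  by (simp add: trace_def sum_distrib_left)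

lemma trace_minus: "trace (- (A :: real^'n^'n)) = - trace A"
  by (simp add: trace_def sum_negf)

lemma bounded_linear_trace: "bounded_linear (trace :: real^'n^'n \<Rightarrow> real)"
  by (intro linear_conv_bounded_linear[THEN iffD1] linearI) (simp_all add: trace_add trace_scaleR)

lemmas has_derivative_trace [derivative_intros] =
  bounded_linear.has_derivative[OF bounded_linear_trace]

section \<open>Traces of left and right matrix multiplication\<close>

lemma sum_Basis_matrix:
  "(\<Sum>b\<in>Basis. f (b :: real^'n^'m)) = (\<Sum>i\<in>UNIV. \<Sum>j\<in>UNIV. f (axis i (axis j 1)))"
proof -
  have B: "(Basis :: (real^'n^'m) set) = (\<lambda>(i, j). axis i (axis j 1)) ` UNIV"
    by (auto simp: Basis_vec_def image_iff)
  have "inj (\<lambda>(i, j). axis i (axis j 1) :: real^'n^'m)"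
    by (auto simp: inj_on_def axis_eq_axis)
  thus ?thesis
    unfolding B by (simp add: sum.reindex case_prod_unfold sum.cartesian_product)
qed

lemma inner_matrix_unit: "A \<bullet> axis i (axis j 1) = (A :: real^'n^'m) $ i $ j"
  by (simp add: inner_axis)

lemma matrix_unit_nth: "(axis i (axis j c) :: real^'n^'m) $ k $ l = (if k = i \<and> l = j then c else 0)"
  by (simp add: axis_def)

text \<open>For the matrix unit \<open>b\<close> with entry 1 at (i, j), the summand is
  \<open>B $ j $ j\<close>. It is independent of i, so every diagonal entry is counted
  \<open>CARD('m)\<close> times.\<close>

lemma trace_mul_right_endomorphism:
  "(\<Sum>b::real^'n^'m\<in>Basis. (b ** B) \<bullet> b) = CARD('m) * trace (B :: real^'n^'n)"
proof -
  have "(axis i (axis j 1) ** B) $ i $ j = B $ j $ j" for i :: 'm and j :: 'n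
    by (simp add: matrix_matrix_mult_def matrix_unit_nth if_distrib[of "\<lambda>c. c * _"] cong: if_cong)
  thus ?thesis
    by (simp add: sum_Basis_matrix inner_matrix_unit trace_def)
qed

lemma trace_mul_left_endomorphism:
  "(\<Sum>b::real^'m^'n\<in>Basis. (B ** b) \<bullet> b) = CARD('m) * trace (B :: real^'n^'n)"
proof -
  have "(B ** axis i (axis j 1)) $ i $ j = B $ i $ i" for i :: 'n and j :: 'm
    by (simp add: matrix_matrix_mult_def matrix_unit_nth if_distrib[of "\<lambda>c. _ * c"] cong: if_cong)
  thus ?thesis
    by (simp add: sum_Basis_matrix inner_matrix_unit trace_def sum_distrib_left)
qed

section \<open>Continuity and derivative of matrix inversion\<close>

lemma continuous_on_det [continuous_intros]:
  assumes "\<And>i j. continuous_on S (\<lambda>x. f x $ i $ j)"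
  shows "continuous_on S (\<lambda>x. det (f x :: real^'n^'n))"
  unfolding det_def by (intro continuous_intros assms)

text \<open>Cramer's rule writes each entry as a quotient of determinants whose denominator does not
  vanish on \<open>GL\<close>.\<close>

lemma continuous_on_matrix_inv: "continuous_on GL (matrix_inv :: real^'n^'n \<Rightarrow> real^'n^'n)"
proof -
  let ?C = "\<lambda>x k l. det (\<chi> i j. if j = k then axis l 1 $ i else x $ i $ j) / det (x :: real^'n^'n)"
  have eq: "matrix_inv x = (\<chi> k l. ?C x k l)" if "x \<in> GL" for x :: "real^'n^'n"
  proof -
    have "det x \<noteq> 0"
      using that by (simp add: GL_def invertible_det_nz)
    moreover have "x *v (matrix_inv x *v axis l 1) = axis l 1" for l
      by (simp add: matrix_vector_mul_assoc matrix_inv_inverse[OF that])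
    ultimately have "matrix_inv x *v axis l 1 = (\<chi> k. ?C x k l)" for l
      using cramer by blast
    thus ?thesis
      by (simp add: vec_eq_iff matrix_vector_mult_basis column_def)
  qed
  have "continuous_on S (\<lambda>x. if j = k then axis l 1 $ i else x $ i $ j)"
    for S :: "(real^'n^'n) set" and i j k l
    by (cases "j = k") (auto intro!: continuous_intros)
  hence "continuous_on GL (\<lambda>x :: real^'n^'n. \<chi> k l. ?C x k l)"
    by (intro continuous_on_vec_lambda continuous_on_divide continuous_on_det)
       (auto simp: GL_def invertible_det_nz intro!: continuous_intros)
  thus ?thesis
    by (simp add: eq cong: continuous_on_cong)
qed

text \<open>
  Since \<open>y\<^sup>-\<^sup>1 - x\<^sup>-\<^sup>1 = - y\<^sup>-\<^sup>1 (y - x) x\<^sup>-\<^sup>1\<close>, the error term of the linear approximation is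
  \<open>(x\<^sup>-\<^sup>1 - y\<^sup>-\<^sup>1) (y - x) x\<^sup>-\<^sup>1\<close>.
\<close>

lemma has_derivative_matrix_inv:
  fixes x :: "real^'n^'n"
  assumes "x \<in> GL"
  shows "(matrix_inv has_derivative (\<lambda>h. - (matrix_inv x ** h ** matrix_inv x))) (at x)"
proof -
  interpret mm: bounded_bilinear "(**) :: real^'n^'n \<Rightarrow> real^'n^'n \<Rightarrow> real^'n^'n"
    by (rule bounded_bilinear_matrix_mul)
  obtain K where K: "K > 0" "\<And>A B. norm (A ** B :: real^'n^'n) \<le> norm (A :: real^'n^'n) * norm (B :: real^'n^'n) * K"
    using mm.pos_bounded by blast
  obtain e where e: "e > 0" "ball x e \<subseteq> GL"
    using open_GL assms open_contains_ball by blast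
  \<comment> \<open>\<open>?H\<close> bounds the error quotient: the error is a product of three
    matrices, hence the two factors \<open>K\<close>, and its first factor tends to 0 by continuity
    of inversion.\<close>
  let ?H = "\<lambda>y. norm (matrix_inv x - matrix_inv y) * K * norm (matrix_inv x) * K"
  show ?thesis
  proof (rule has_derivativeI_sandwich[OF e(1)])
    show "bounded_linear (\<lambda>h. - (matrix_inv x ** h ** matrix_inv x))"
      by (intro bounded_linear_minus mm.bounded_linear_right
          bounded_linear_compose[OF mm.bounded_linear_left])
  next
    fix y assume "y \<noteq> x" "dist y x < e"
    hence y: "y \<in> GL"
      using e by (auto simp: dist_commute)
    note xy = matrix_inv_inverse[OF assms] matrix_inv_inverse[OF y]
    have "matrix_inv y ** x ** matrix_inv x = matrix_inv y"
      by (simp add: matrix_mul_assoc[symmetric] xy)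
    hence "matrix_inv y - matrix_inv x - - (matrix_inv x ** (y - x) ** matrix_inv x)
        = (matrix_inv x - matrix_inv y) ** (y - x) ** matrix_inv x"
      by (simp only: mm.diff_left mm.diff_right xy matrix_mul_lid) simp
    also have "norm \<dots> \<le> norm ((matrix_inv x - matrix_inv y) ** (y - x)) * norm (matrix_inv x) * K"
      by (rule K(2))
    also have "\<dots> \<le> (norm (matrix_inv x - matrix_inv y) * norm (y - x) * K) * norm (matrix_inv x) * K"
      using K by (intro mult_right_mono) auto
    also have "\<dots> = ?H y * norm (y - x)"
      by simp
    finally show "norm (matrix_inv y - matrix_inv x - - (matrix_inv x ** (y - x) ** matrix_inv x))
        / norm (y - x) \<le> ?H y"
      using \<open>y \<noteq> x\<close> by (simp add: field_simps)
  next
    have "isCont matrix_inv x"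
      using continuous_on_matrix_inv open_GL assms continuous_on_eq_continuous_at by blast
    hence "(?H \<longlongrightarrow> norm (matrix_inv x - matrix_inv x) * K * norm (matrix_inv x) * K) (at x)"
      by (intro tendsto_intros) (simp add: isCont_def)
    thus "(?H \<longlongrightarrow> 0) (at x)"
      by simp
  qed
qed


subsection \<open>The metric of \<open>GL\<^sub>n(\<real>)\<close>\<close>

text \<open>Nondegeneracy, applied to \<open>V - W\<close>, gives the uniqueness in the definite
  descriptions of \<open>grad\<close> and \<open>christoffel\<close>.\<close>

lemma gl_metric_eqI:
  assumes "x \<in> GL" and "\<And>Z. gl_metric x V Z = gl_metric x W Z"
  shows "V = W"
proof -
  have "gl_metric x (V - W) Z = 0" for Z
    using assms(2) gl_metric_bilinear[of x] by (simp add: bilinear_lsub)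
  thus ?thesis
    using gl_metric_nondegenerate[OF assms(1), of "V - W"] by simp
qed

section \<open>Gradient, Christoffel symbols and divergence\<close>

lemma grad_gl_metric:
  fixes x P :: "real^'n^'n"
  assumes "x \<in> GL" and "\<And>y. y \<in> GL \<Longrightarrow> u y = trace (P ** y)"
  shows "grad gl_metric u x = - (x ** P ** x)"
proof -
  have "((\<lambda>y. trace (P ** y)) has_derivative (\<lambda>Y. trace (P ** Y))) (at x)"
    by (auto intro!: derivative_eq_intros)
  hence "(u has_derivative (\<lambda>Y. trace (P ** Y))) (at x)"
    by (rule has_derivative_transform_within_open[OF _ open_GL assms(1)]) (simp add: assms(2))
  hence D: "frechet_derivative u (at x) = (\<lambda>Y. trace (P ** Y))"
    by (rule frechet_derivative_at[symmetric])
  have eq: "gl_metric x (- (x ** P ** x)) Y = trace (P ** Y)" for Y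
  proof -
    have "matrix_inv x ** (x ** P ** x) ** (matrix_inv x ** Y)
        = (matrix_inv x ** x) ** P ** (x ** matrix_inv x) ** Y"
      by (simp only: matrix_mul_assoc)
    thus ?thesis
      by (simp add: gl_metric_def gl_form_def matrix_mul_minus_left matrix_mul_minus_right
          trace_minus matrix_inv_inverse[OF assms(1)])
  qed
  show ?thesis
    unfolding grad_def D
    by (rule the_equality) (auto simp: eq intro: gl_metric_eqI[OF assms(1)])
qed

text \<open>By the product rule each of the two inverses contributes one trace; the minus sign from
  differentiating the inverse cancels that of \<open>gl_form\<close>.\<close>

lemma has_derivative_gl_metric:
  fixes x Y Z :: "real^'n^'n"
  assumes "x \<in> GL"
  defines "i \<equiv> matrix_inv x"
  shows "((\<lambda>y. gl_metric y Y Z) has_derivative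
    (\<lambda>X. trace (i ** X ** i ** Y ** i ** Z) + trace (i ** Y ** i ** X ** i ** Z))) (at x)"
  unfolding gl_metric_def gl_form_def i_def
  by (auto intro!: derivative_eq_intros has_derivative_matrix_inv[OF assms(1)]
      simp: matrix_mul_minus_left matrix_mul_minus_right matrix_mul_diff_left trace_minus trace_sub matrix_mul_assoc)

lemma christoffel_gl_metric:
  fixes x X Y :: "real^'n^'n"
  assumes "x \<in> GL"
  shows "christoffel gl_metric x X Y
    = - ((1/2) *\<^sub>R (X ** matrix_inv x ** Y + Y ** matrix_inv x ** X))" (is "_ = ?W")
proof -
  let ?i = "matrix_inv x"
  note D = frechet_derivative_at[OF has_derivative_gl_metric[OF assms], symmetric]
  \<comment> \<open>Rotated cyclically, the derivative along \<open>Z\<close> is one copy of the sum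
    that the derivatives along \<open>X\<close> and \<open>Y\<close> together give twice, so one
    copy remains.\<close>
  have cyc: "trace (?i ** Z ** ?i ** A ** ?i ** B) = trace (?i ** A ** ?i ** B ** ?i ** Z)"
    for A B Z
    using trace_mul_sym[of "?i ** Z" "?i ** A ** ?i ** B"] by (simp add: matrix_mul_assoc)
  have "2 * gl_metric x ?W Z = trace (?i ** X ** ?i ** Y ** ?i ** Z)
      + trace (?i ** Y ** ?i ** X ** ?i ** Z)" for Z
    by (simp add: gl_metric_def gl_form_def matrix_mul_minus_left matrix_mul_minus_right
        matrix_mul_scaleR_left matrix_mul_scaleR_right matrix_add_ldistrib matrix_mul_add_left
        trace_minus trace_scaleR trace_add matrix_mul_assoc)
  hence eq: "2 * gl_metric x ?W Z = frechet_derivative (\<lambda>y. gl_metric y Y Z) (at x) X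
      + frechet_derivative (\<lambda>y. gl_metric y X Z) (at x) Y
      - frechet_derivative (\<lambda>y. gl_metric y X Y) (at x) Z" for Z
    unfolding D using cyc[of Z X Y] cyc[of Y X Z] by simp
  show ?thesis
    \<comment> \<open>The Koszul expression becomes \<open>2 * gl_metric x ?W Z\<close>, so the
      description asks for the vector with the same metric products as \<open>?W\<close>.\<close>
    unfolding christoffel_def eq[symmetric]
    by (rule the_equality) (auto intro: gl_metric_eqI[OF assms])
qed

lemma divergence_gl_metric:
  fixes x P :: "real^'n^'n"
  assumes "x \<in> GL" and "\<And>y. y \<in> GL \<Longrightarrow> V y = - (y ** P ** y)"
  shows "divergence gl_metric V x = - real CARD('n) * trace (P ** x)"
proof -
  have "((\<lambda>y. - (y ** P ** y)) has_derivative (\<lambda>X. - (X ** P ** x + x ** P ** X))) (at x)"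
    by (auto intro!: derivative_eq_intros)
  hence "(V has_derivative (\<lambda>X. - (X ** P ** x + x ** P ** X))) (at x)"
    by (rule has_derivative_transform_within_open[OF _ open_GL assms(1)]) (simp add: assms(2))
  hence D: "frechet_derivative V (at x) = (\<lambda>X. - (X ** P ** x + x ** P ** X))"
    by (rule frechet_derivative_at[symmetric])
  have "X ** matrix_inv x ** (x ** P ** x) = X ** P ** x"
    and "x ** P ** x ** matrix_inv x ** X = x ** P ** X" for X
  proof -
    have "X ** matrix_inv x ** (x ** P ** x) = X ** (matrix_inv x ** x) ** P ** x"
      and "x ** P ** x ** matrix_inv x ** X = x ** P ** (x ** matrix_inv x) ** X"
      by (simp_all only: matrix_mul_assoc)
    thus "X ** matrix_inv x ** (x ** P ** x) = X ** P ** x"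
      and "x ** P ** x ** matrix_inv x ** X = x ** P ** X"
      by (simp_all add: matrix_inv_inverse[OF assms(1)])
  qed
  hence "christoffel gl_metric x X (V x) = (1/2) *\<^sub>R (X ** P ** x + x ** P ** X)" for X
    by (simp add: christoffel_gl_metric[OF assms(1)] assms matrix_mul_minus_left
        matrix_mul_minus_right scaleR_right_diff_distrib scaleR_add_right)
  \<comment> \<open>The Christoffel term is minus half the derivative of \<open>V\<close>, so half
    of that derivative survives.\<close>
  hence "levi_civita gl_metric X V x = - ((1/2) *\<^sub>R (X ** (P ** x) + (x ** P) ** X))" for X
    unfolding levi_civita_def D
    by (simp add: matrix_mul_assoc vec_eq_iff field_simps)
  hence "divergence gl_metric V x = - (1/2) * ((\<Sum>X::real^'n^'n\<in>Basis. (X ** (P ** x)) \<bullet> X)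
      + (\<Sum>X::real^'n^'n\<in>Basis. ((x ** P) ** X) \<bullet> X))"
    by (simp add: divergence_def inner_add_left inner_diff_left sum.distrib sum_negf sum_subtractf
        sum_divide_distrib add_divide_distrib)
  also have "\<dots> = - real CARD('n) * trace (P ** x)"
    by (simp only: trace_mul_right_endomorphism trace_mul_left_endomorphism trace_mul_sym[of x P])
       simp
  finally show ?thesis .
qed


subsection \<open>The functions \<open>\<phi>\<^sub>a\<close>\<close>

lemma phi_eq_sum:
  "x \<in> GL \<Longrightarrow> phi v a x = (\<Sum>j\<in>UNIV. \<Sum>k\<in>UNIV. v $ j * a $ k * of_real (x $ j $ k))"
  by (simp add: phi_def trace_def outer_def matrix_matrix_mult_def transpose_def map_matrix_def)

text \<open>As \<open>x\<close> is real, real and imaginary parts fall on the coefficients alone.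
  They are indexed \<open>k j\<close> because \<open>trace (P ** x)\<close> pairs
  \<open>P $ k $ j\<close> with \<open>x $ j $ k\<close>.\<close>

lemma Re_phi: "x \<in> GL \<Longrightarrow> Re (phi v a x) = trace ((\<chi> k j. Re (v $ j * a $ k)) ** x)"
  and Im_phi: "x \<in> GL \<Longrightarrow> Im (phi v a x) = trace ((\<chi> k j. Im (v $ j * a $ k)) ** x)"
  unfolding phi_eq_sum trace_def matrix_matrix_mult_def
  by (subst sum.swap, simp add: left_diff_distrib distrib_right mult.assoc)
     (subst sum.swap, simp add: left_diff_distrib distrib_right mult.assoc)

lemma cgrad_phi:
  assumes "x \<in> GL"
  shows "cgrad gl_metric (phi v a) x =
    (- (x ** (\<chi> k j. Re (v $ j * a $ k)) ** x), - (x ** (\<chi> k j. Im (v $ j * a $ k)) ** x))"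
  unfolding cgrad_def by (simp add: grad_gl_metric[OF assms] Re_phi Im_phi)

lemma tension_phi:
  fixes x :: "real^'n^'n"
  assumes "x \<in> GL"
  shows "tension gl_metric (phi v a) x = - of_nat CARD('n) * phi v a x"
  unfolding tension_def cdivergence_def
  by (simp add: divergence_gl_metric[OF assms] cgrad_phi Re_phi[OF assms] Im_phi[OF assms]
      complex_eq_iff)

text \<open>Expanded into entries so that the four real metric values in \<open>cmetric\<close>
  merge summand by summand into one complex product.\<close>

lemma gl_metric_translate:
  fixes x P Q :: "real^'n^'n"
  assumes "x \<in> GL"
  shows "gl_metric x (- (x ** P ** x)) (- (x ** Q ** x)) =
    - (\<Sum>k\<in>UNIV. \<Sum>j\<in>UNIV. \<Sum>l\<in>UNIV. \<Sum>m\<in>UNIV.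
        P $ k $ j * x $ j $ l * (Q $ l $ m * x $ m $ k))"
proof -
  have "matrix_inv x ** (x ** A ** x) = A ** x" for A
    by (simp add: matrix_mul_assoc matrix_inv_inverse[OF assms])
  hence "gl_metric x (- (x ** P ** x)) (- (x ** Q ** x)) = - trace ((P ** x) ** (Q ** x))"
    by (simp add: gl_metric_def gl_form_def matrix_mul_minus_left matrix_mul_minus_right)
  also have "trace ((P ** x) ** (Q ** x)) = (\<Sum>k\<in>UNIV. \<Sum>l\<in>UNIV. \<Sum>j\<in>UNIV. \<Sum>m\<in>UNIV.
        P $ k $ j * x $ j $ l * (Q $ l $ m * x $ m $ k))"
    by (simp add: trace_def matrix_matrix_mult_def sum_product)
  also have "\<dots> = (\<Sum>k\<in>UNIV. \<Sum>j\<in>UNIV. \<Sum>l\<in>UNIV. \<Sum>m\<in>UNIV.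
        P $ k $ j * x $ j $ l * (Q $ l $ m * x $ m $ k))"
    by (intro sum.cong refl sum.swap)
  finally show ?thesis .
qed

lemma conformality_phi:
  fixes x :: "real^'n^'n"
  assumes "x \<in> GL"
  shows "conformality gl_metric (phi v a) (phi v b) x = - (phi v a x * phi v b x)"
proof -
  have "conformality gl_metric (phi v a) (phi v b) x =
      - (\<Sum>k\<in>UNIV. \<Sum>j\<in>UNIV. \<Sum>l\<in>UNIV. \<Sum>m\<in>UNIV. (v $ j * a $ k) * of_real (x $ j $ l)
          * ((v $ m * b $ l) * of_real (x $ m $ k)))"
    unfolding conformality_def cmetric_def cgrad_phi[OF assms] fst_conv snd_conv
      gl_metric_translate[OF assms] vec_lambda_beta
    by (simp add: complex_eq_iff sum_subtractf[symmetric] sum.distrib[symmetric]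
        sum_negf[symmetric] del: sum_subtractf sum.distrib sum_negf)
  \<comment> \<open>The coefficient matrices have rank one, so \<open>v $ j\<close> and
    \<open>v $ m\<close> can trade places: the summand separates into a factor in \<open>k\<close>,
    \<open>m\<close> and one in \<open>j\<close>, \<open>l\<close>.\<close>
  also have "(\<Sum>k\<in>UNIV. \<Sum>j\<in>UNIV. \<Sum>l\<in>UNIV. \<Sum>m\<in>UNIV. (v $ j * a $ k) * of_real (x $ j $ l)
          * ((v $ m * b $ l) * of_real (x $ m $ k)))
      = (\<Sum>k\<in>UNIV. \<Sum>m\<in>UNIV. \<Sum>j\<in>UNIV. \<Sum>l\<in>UNIV. (v $ m * a $ k * of_real (x $ m $ k))
          * (v $ j * b $ l * of_real (x $ j $ l)))"
    by (subst (2) sum.swap, rule sum.cong[OF refl], subst sum.swap)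
       (auto intro!: sum.cong simp: mult_ac)
  also have "\<dots> = (\<Sum>k\<in>UNIV. \<Sum>m\<in>UNIV. v $ m * a $ k * of_real (x $ m $ k)) * phi v b x"
    by (simp only: sum_distrib_right) (simp only: phi_eq_sum[OF assms] sum_distrib_left)
  also have "(\<Sum>k\<in>UNIV. \<Sum>m\<in>UNIV. v $ m * a $ k * of_real (x $ m $ k)) = phi v a x"
    unfolding phi_eq_sum[OF assms] by (rule sum.swap)
  finally show ?thesis .
qed

section \<open>Smoothness, linearity and dimension of the family\<close>

lemma smooth_on_phi:
  fixes v a :: "complex^'n"
  shows "smooth_on GL (phi v a)"
proof -
  let ?f = "\<lambda>x :: real^'n^'n. \<Sum>j\<in>UNIV. \<Sum>k\<in>UNIV. v $ j * a $ k * of_real (x $ j $ k)"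
  have "bounded_linear ?f"
    by (intro bounded_linear_sum bounded_linear_const_mult
        bounded_linear_compose[OF bounded_linear_of_real]
        bounded_linear_compose[OF bounded_linear_vec_nth] bounded_linear_vec_nth)
  hence "smooth_on GL ?f"
    by (rule smooth_on_bounded_linear)
  thus ?thesis
    unfolding smooth_on_def using Ck_on_cong[OF open_GL, of "phi v a" ?f] by (simp add: phi_eq_sum)
qed

text \<open>Off \<open>GL\<close> both sides are 0, so the identities hold on all matrices. This
  makes \<open>E_fam v\<close> the range of a linear map.\<close>

lemma linear_phi: "Vector_Spaces.linear (*s) cscale (phi v)"
proof -
  have "phi v (a + b) = phi v a + phi v b" and "phi v (c *s a) = cscale c (phi v a)" for a b c
    by (auto simp: fun_eq_iff phi_def trace_def outer_def matrix_matrix_mult_def cscale_def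
        algebra_simps sum.distrib sum_distrib_left)
  thus ?thesis
    by unfold_locales auto
qed

text \<open>
  As \<open>GL\<close> is open, it contains \<open>1 + t E\<close> for every matrix unit \<open>E\<close> and small \<open>t \<noteq> 0\<close>; the values
  of \<open>\<phi>\<^sub>a\<close> there and at \<open>1\<close> determine \<open>v\<^sub>j a\<^sub>k\<close>.
\<close>

lemma phi_eq_0_imp:
  fixes v a :: "complex^'n"
  assumes "v \<noteq> 0" and "phi v a = 0"
  shows "a = 0"
proof -
  obtain j where j: "v $ j \<noteq> 0"
    using assms(1) by (auto simp: vec_eq_iff)
  have one: "mat 1 \<in> (GL :: (real^'n^'n) set)"
    by (auto simp: GL_def invertible_def)
  \<comment> \<open>The ball is closed because \<open>mat 1 + e *\<^sub>R E\<close> lies at distance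
    exactly \<open>e\<close> from \<open>mat 1\<close>.\<close>
  then obtain e where e: "e > 0" "cball (mat 1) e \<subseteq> (GL :: (real^'n^'n) set)"
    using open_GL open_contains_cball by blast
  have "a $ k = 0" for k
  proof -
    define E :: "real^'n^'n" where "E = axis j (axis k 1)"
    have "norm E = 1"
      by (auto simp: E_def intro!: norm_Basis)
    hence t: "mat 1 + e *\<^sub>R E \<in> GL"
      using e by (intro subsetD[OF e(2)]) (simp add: dist_norm)
    have "phi v a (mat 1 + e *\<^sub>R E) - phi v a (mat 1) =
        (\<Sum>i\<in>UNIV. \<Sum>l\<in>UNIV. v $ i * a $ l * of_real (e * E $ i $ l))"
      by (simp add: phi_eq_sum[OF t] phi_eq_sum[OF one] sum_subtractf[symmetric] algebra_simps
          del: sum_subtractf)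
    also have "\<dots> = (\<Sum>i\<in>UNIV. \<Sum>l\<in>UNIV. if i = j then if l = k then v $ j * a $ k * of_real e else 0 else 0)"
      by (intro sum.cong refl) (simp add: E_def matrix_unit_nth)
    also have "\<dots> = v $ j * a $ k * of_real e"
      by (subst sum.swap) (simp cong: if_cong)
    finally show ?thesis
      using assms(2) j e(1) by simp
  qed
  thus ?thesis
    by (simp add: vec_eq_iff)
qed

theorem theorem6p2:
  fixes v :: "complex^'n"
  assumes "v \<noteq> 0"
  shows "cfun.subspace (E_fam v) \<and> cfun.dim (E_fam v) = CARD('n) \<and>
    eigenfamily GL gl_metric (E_fam v) \<and>
    (\<forall>\<phi>\<in>E_fam v. \<forall>\<psi>\<in>E_fam v. \<forall>x\<in>GL.
       tension gl_metric \<phi> x = - of_nat CARD('n) * \<phi> x \<and>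
       conformality gl_metric \<phi> \<psi> x = - (\<phi> x * \<psi> x))"
proof -
  \<comment> \<open>Finite dimension is asserted on the domain side only: the space of all complex
    functions on matrices is infinite-dimensional.\<close>
  interpret P: finite_dimensional_vector_space_pair_1
    "(*s) :: complex \<Rightarrow> complex^'n \<Rightarrow> complex^'n" cart_basis
    "cscale :: complex \<Rightarrow> (real^'n^'n \<Rightarrow> complex) \<Rightarrow> real^'n^'n \<Rightarrow> complex" ..
  interpret L: Vector_Spaces.linear "(*s)" cscale "phi v"
    by (rule linear_phi)
  have E: "E_fam v = phi v ` UNIV"
    by (auto simp: E_fam_def)
  have "inj (phi v)"
    using phi_eq_0_imp[OF assms] L.inj_iff_eq_0 by blast
  hence "cfun.dim (E_fam v) = CARD('n)"
    unfolding E using P.dim_image_eq[OF linear_phi, of v UNIV] by (simp add: card_cart_basis)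
  moreover have "cfun.subspace (E_fam v)"
    unfolding E by (rule L.subspace_image) simp
  moreover have eigen: "tension gl_metric \<phi> x = - of_nat CARD('n) * \<phi> x \<and>
       conformality gl_metric \<phi> \<psi> x = - (\<phi> x * \<psi> x)"
    if "\<phi> \<in> E_fam v" "\<psi> \<in> E_fam v" "x \<in> GL" for \<phi> \<psi> x
    using that tension_phi conformality_phi by (auto simp: E_fam_def)
  moreover have "eigenfamily GL gl_metric (E_fam v)"
    unfolding eigenfamily_def
  proof (intro conjI)
    show "\<forall>\<phi>\<in>E_fam v. smooth_on GL \<phi>"
      by (auto simp: E_fam_def smooth_on_phi)
    show "\<exists>l m. \<forall>\<phi>\<in>E_fam v. \<forall>\<psi>\<in>E_fam v. \<forall>x\<in>GL.
        tension gl_metric \<phi> x = l * \<phi> x \<and> conformality gl_metric \<phi> \<psi> x = m * \<phi> x * \<psi> x"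
      by (rule exI[of _ "- of_nat CARD('n)"], rule exI[of _ "- 1"]) (simp add: eigen)
  qed
  ultimately show ?thesis
    by blast
qed

end
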